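(* Let $(X,p)$ be a TVS-cone metric space over a cone $P$ with nonempty interior in a real Hausdorff locally convex topological vector space $E$. Then $(X,\tau_p)$ is a first countable topological space.
   Context: $E$ is a real Hausdorff locally convex topological vector space. A cone is a non-empty subset $P\subset E$ with $P+P\subset P$, $\lambda P\subset P$ for all $\lambda\ge 0$, and $P\cap(-P)=\{0\}$; $P$ is always assumed closed with nonempty interior $\operatorname{int}P$. Write $x\le y$ iff $y-x\in P$, and $x\ll y$ iff $y-x\in\operatorname{int}P$. A TVS-cone metric space (TVS-CMS) $(X,p)$ is a non-empty set $X$ with a map $p:X\times X\to E$ such that for all $x,y,z\in X$: $0\le p(x,y)$; $p(x,y)=0$ iff $x=y$; $p(x,y)=p(y,x)$; $p(x,y)\le p(x,z)+p(z,y)$. For $x\in X$ and $c\gg 0$ put $B(x,c)=\{y\in X: p(x,y)\ll c\}$, and let $\tau_p=\{U\subseteq X: \forall x\in U\ \exists c\gg 0 \text{ with } B(x,c)\subseteq U\}\cup\{\emptyset\}$. *)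

theory Defs
  imports "HOL-Analysis.Analysis"
begin

class topological_real_vector = real_vector + topological_ab_group_add +
  assumes tendsto_scaleR_Pair:
    "LIM x (nhds r \<times>\<^sub>F nhds a). fst x *\<^sub>R snd x :> nhds (r *\<^sub>R a)"

text \<open>The class body cannot mention \<^const>\<open>convex\<close>, whose type carries a sort constraint, so
  its definition is written out; lemma \<open>ex_convex_open_nhds_0\<close> restates the axiom.\<close>

class hausdorff_locally_convex = topological_real_vector + t2_space +
  assumes convex_open_nhds_0:
    "open U \<Longrightarrow> 0 \<in> U \<Longrightarrow> \<exists>V. open V \<and> 0 \<in> V \<and> V \<subseteq> U \<and>
       (\<forall>x\<in>V. \<forall>y\<in>V. \<forall>u\<ge>0. \<forall>v\<ge>0. u + v = 1 \<longrightarrow> u *\<^sub>R x + v *\<^sub>R y \<in> V)"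

lemma ex_convex_open_nhds_0:
  fixes U :: "'e::hausdorff_locally_convex set"
  assumes "open U" "0 \<in> U"
  shows "\<exists>V. open V \<and> convex V \<and> 0 \<in> V \<and> V \<subseteq> U"
  using convex_open_nhds_0[OF assms] unfolding convex_def by blast

instance real_normed_vector \<subseteq> hausdorff_locally_convex
proof
  fix r :: real and a :: 'a
  show "LIM x (nhds r \<times>\<^sub>F nhds a). fst x *\<^sub>R snd x :> nhds (r *\<^sub>R a)"
    by (intro tendsto_scaleR filterlim_fst filterlim_snd)
next
  fix U :: "'a set"
  assume "open U" "0 \<in> U"
  then obtain e where "e > 0" "ball 0 e \<subseteq> U"
    by (meson openE)
  then show "\<exists>V. open V \<and> 0 \<in> V \<and> V \<subseteq> U \<and>
       (\<forall>x\<in>V. \<forall>y\<in>V. \<forall>u\<ge>0. \<forall>v\<ge>0. u + v = 1 \<longrightarrow> u *\<^sub>R x + v *\<^sub>R y \<in> V)"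
    using convex_ball[of "0::'a" e, unfolded convex_def] \<open>e > 0\<close>
    by (intro exI[of _ "ball 0 e"]) (simp del: mem_ball add: centre_in_ball)
qed

text \<open>The library's \<^const>\<open>cone\<close> and \<^const>\<open>convex_cone\<close> do not require pointedness.\<close>

definition pointed_cone :: "'e::real_vector set \<Rightarrow> bool" where
  "pointed_cone P \<longleftrightarrow>
     P \<noteq> {} \<and>
     (\<forall>x\<in>P. \<forall>y\<in>P. x + y \<in> P) \<and>
     (\<forall>r\<ge>0. \<forall>x\<in>P. r *\<^sub>R x \<in> P) \<and>
     P \<inter> uminus ` P = {0}"

definition cone_le :: "'e::real_vector set \<Rightarrow> 'e \<Rightarrow> 'e \<Rightarrow> bool" where
  "cone_le P x y \<longleftrightarrow> y - x \<in> P"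

definition cone_ll :: "'e::hausdorff_locally_convex set \<Rightarrow> 'e \<Rightarrow> 'e \<Rightarrow> bool" where
  "cone_ll P x y \<longleftrightarrow> y - x \<in> interior P"

definition tvs_cone_metric_space ::
  "'e::hausdorff_locally_convex set \<Rightarrow> 'a set \<Rightarrow> ('a \<Rightarrow> 'a \<Rightarrow> 'e) \<Rightarrow> bool" where
  "tvs_cone_metric_space P X p \<longleftrightarrow>
     X \<noteq> {} \<and>
     (\<forall>x\<in>X. \<forall>y\<in>X. cone_le P 0 (p x y)) \<and>
     (\<forall>x\<in>X. \<forall>y\<in>X. p x y = 0 \<longleftrightarrow> x = y) \<and>
     (\<forall>x\<in>X. \<forall>y\<in>X. p x y = p y x) \<and>
     (\<forall>x\<in>X. \<forall>y\<in>X. \<forall>z\<in>X. cone_le P (p x y) (p x z + p z y))"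

definition cone_ball ::
  "'e::hausdorff_locally_convex set \<Rightarrow> 'a set \<Rightarrow> ('a \<Rightarrow> 'a \<Rightarrow> 'e) \<Rightarrow> 'a \<Rightarrow> 'e \<Rightarrow> 'a set" where
  "cone_ball P X p x c = {y \<in> X. cone_ll P (p x y) c}"

definition cone_opens ::
  "'e::hausdorff_locally_convex set \<Rightarrow> 'a set \<Rightarrow> ('a \<Rightarrow> 'a \<Rightarrow> 'e) \<Rightarrow> 'a set set" where
  "cone_opens P X p =
     {U. U \<subseteq> X \<and> (\<forall>x\<in>U. \<exists>c. cone_ll P 0 c \<and> cone_ball P X p x c \<subseteq> U)} \<union> {{}}"

text \<open>The value of \<^const>\<open>topology\<close> is unspecified for families that are not topologies, so
  statements about \<open>cone_topology\<close> are only meaningful together with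
  \<open>istopology (\<lambda>U. U \<in> cone_opens P X p)\<close>.\<close>

definition cone_topology ::
  "'e::hausdorff_locally_convex set \<Rightarrow> 'a set \<Rightarrow> ('a \<Rightarrow> 'a \<Rightarrow> 'e) \<Rightarrow> 'a topology" where
  "cone_topology P X p = topology (\<lambda>U. U \<in> cone_opens P X p)"

end

theory Submission
  imports Defs
begin

text \<open>
  Fix an interior point \<open>e\<close> of the cone. For every \<open>c \<ggreater> 0\<close> the points \<open>c - e / n\<close> converge to
  \<open>c\<close>, so they eventually lie in the open set \<open>interior P\<close>
  (\<open>eventually_cone_ll_inverse_scaleR\<close>): all but finitely many \<open>e / n\<close> lie below any given radius.
  Since \<open>interior P + P \<subseteq> interior P\<close> (\<open>interior_cone_add\<close>), passing to a radius smaller for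
  \<open>\<lless>\<close> shrinks the ball. So the countably many balls \<open>B(x, e / n)\<close> are cofinal among all balls
  at \<open>x\<close>, and two balls at \<open>x\<close> always contain a common third one, which makes \<open>cone_opens\<close>
  closed under binary intersections. Finally, the triangle inequality makes every ball open, just as
  in a metric space (\<open>cone_ball_in_cone_opens\<close>), so the balls \<open>B(x, e / n)\<close> form a countable
  base of open sets at \<open>x\<close>.
\<close>

lemma tendsto_scaleR_topological_real_vector:
  fixes a :: "'e::topological_real_vector"
  assumes "(f \<longlongrightarrow> r) F" "(g \<longlongrightarrow> a) F"
  shows "((\<lambda>x. f x *\<^sub>R g x) \<longlongrightarrow> r *\<^sub>R a) F"
  using filterlim_compose[OF tendsto_scaleR_Pair filterlim_Pair[OF assms]] by simp

lemma pointed_cone_add: "pointed_cone P \<Longrightarrow> x \<in> P \<Longrightarrow> y \<in> P \<Longrightarrow> x + y \<in> P"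
  and pointed_cone_scaleR: "pointed_cone P \<Longrightarrow> x \<in> P \<Longrightarrow> 0 \<le> r \<Longrightarrow> r *\<^sub>R x \<in> P"
  unfolding pointed_cone_def by blast+

text \<open>The translate of \<open>interior P\<close> by a point of \<open>P\<close> is an open subset of \<open>P\<close>.\<close>

lemma interior_cone_add:
  fixes P :: "'e::hausdorff_locally_convex set"
  assumes P: "pointed_cone P" and a: "a \<in> interior P" and b: "b \<in> P"
  shows "a + b \<in> interior P"
proof (rule interiorI)
  show "open ((\<lambda>y. y - b) -` interior P)"
    by (intro open_vimage open_interior continuous_intros)
  show "a + b \<in> (\<lambda>y. y - b) -` interior P"
    using a by simp
  show "(\<lambda>y. y - b) -` interior P \<subseteq> P"
    using pointed_cone_add[OF P _ b] interior_subset[of P] by force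
qed

lemma interior_cone_scaleR:
  fixes P :: "'e::hausdorff_locally_convex set"
  assumes P: "pointed_cone P" and a: "a \<in> interior P" and t: "0 < t"
  shows "t *\<^sub>R a \<in> interior P"
proof (rule interiorI)
  have "continuous_on UNIV (\<lambda>y::'e. inverse t *\<^sub>R y)"
    unfolding continuous_on_def
    by (intro ballI tendsto_scaleR_topological_real_vector tendsto_const tendsto_ident_at)
  then show "open ((\<lambda>y. inverse t *\<^sub>R y) -` interior P)"
    by (intro open_vimage open_interior)
  show "t *\<^sub>R a \<in> (\<lambda>y. inverse t *\<^sub>R y) -` interior P"
    using a t by simp
  show "(\<lambda>y. inverse t *\<^sub>R y) -` interior P \<subseteq> P"
  proof
    fix y
    assume "y \<in> (\<lambda>y. inverse t *\<^sub>R y) -` interior P"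
    then have "inverse t *\<^sub>R y \<in> P"
      using interior_subset by auto
    then have "t *\<^sub>R inverse t *\<^sub>R y \<in> P"
      using pointed_cone_scaleR[OF P] t by (meson less_imp_le)
    then show "y \<in> P"
      using t by simp
  qed
qed

lemma cone_ll_inverse_scaleR:
  assumes "pointed_cone P" and "e \<in> interior P"
  shows "cone_ll P 0 (inverse (real (Suc n)) *\<^sub>R e)"
  using interior_cone_scaleR[OF assms] by (simp add: cone_ll_def)

text \<open>An Archimedean property of radii: \<open>c - e / n\<close> tends to \<open>c\<close> by continuity of scalar
  multiplication, and \<open>c\<close> lies in the open set \<open>interior P\<close>. The form with \<open>eventually\<close> allows a
  single \<open>n\<close> to serve two radii.\<close>

lemma eventually_cone_ll_inverse_scaleR:
  fixes P :: "'e::hausdorff_locally_convex set"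
  assumes "cone_ll P 0 c"
  shows "\<forall>\<^sub>F n in sequentially. cone_ll P (inverse (real (Suc n)) *\<^sub>R e) c"
proof -
  have "(\<lambda>n. c - inverse (real (Suc n)) *\<^sub>R e) \<longlonglongrightarrow> c - 0 *\<^sub>R e"
    by (intro tendsto_diff tendsto_scaleR_topological_real_vector tendsto_const
        LIMSEQ_inverse_real_of_nat)
  then show ?thesis
    using assms topological_tendstoD[OF _ open_interior[of P]] by (simp add: cone_ll_def)
qed

lemma cone_ball_subset:
  fixes P :: "'e::hausdorff_locally_convex set"
  assumes P: "pointed_cone P" and cd: "cone_ll P c d"
  shows "cone_ball P X p x c \<subseteq> cone_ball P X p x d"
proof
  fix y
  assume "y \<in> cone_ball P X p x c"
  then have "y \<in> X" and y: "c - p x y \<in> interior P"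
    by (simp_all add: cone_ball_def cone_ll_def)
  moreover have "d - c \<in> P"
    using cd interior_subset by (auto simp: cone_ll_def)
  then have "(c - p x y) + (d - c) \<in> interior P"
    by (rule interior_cone_add[OF P y])
  ultimately show "y \<in> cone_ball P X p x d"
    by (simp add: cone_ball_def cone_ll_def)
qed

lemma centre_in_cone_ball:
  assumes "tvs_cone_metric_space P X p" and x: "x \<in> X" and "cone_ll P 0 c"
  shows "x \<in> cone_ball P X p x c"
proof -
  have "\<forall>x\<in>X. \<forall>y\<in>X. p x y = 0 \<longleftrightarrow> x = y"
    using assms(1) unfolding tvs_cone_metric_space_def by (elim conjE)
  then have "p x x = 0"
    using x by blast
  then show ?thesis
    using assms(2,3) by (simp add: cone_ball_def)
qed

text \<open>The radius \<open>c - p x y\<close> works at each point \<open>y\<close> of the ball, by the triangle inequality.\<close>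

lemma cone_ball_in_cone_opens:
  fixes P :: "'e::hausdorff_locally_convex set"
  assumes P: "pointed_cone P" and M: "tvs_cone_metric_space P X p" and x: "x \<in> X"
  shows "cone_ball P X p x c \<in> cone_opens P X p"
proof -
  have "cone_ball P X p y (c - p x y) \<subseteq> cone_ball P X p x c"
    if y: "y \<in> cone_ball P X p x c" for y
  proof
    fix z
    assume z: "z \<in> cone_ball P X p y (c - p x y)"
    then have "p x y + p y z - p x z \<in> P"
      using M x y by (simp add: tvs_cone_metric_space_def cone_le_def cone_ball_def)
    then have "(c - p x y - p y z) + (p x y + p y z - p x z) \<in> interior P"
      using z by (intro interior_cone_add[OF P]) (simp_all add: cone_ball_def cone_ll_def)
    then show "z \<in> cone_ball P X p x c"
      using z by (simp add: cone_ball_def cone_ll_def)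
  qed
  moreover have "cone_ll P 0 (c - p x y)" if "y \<in> cone_ball P X p x c" for y
    using that by (simp add: cone_ball_def cone_ll_def)
  moreover have "cone_ball P X p x c \<subseteq> X"
    by (auto simp: cone_ball_def)
  ultimately show ?thesis
    unfolding cone_opens_def by blast
qed

lemma in_cone_opens_iff:
  "U \<in> cone_opens P X p \<longleftrightarrow>
     U \<subseteq> X \<and> (\<forall>x\<in>U. \<exists>c. cone_ll P 0 c \<and> cone_ball P X p x c \<subseteq> U)"
  unfolding cone_opens_def by blast

lemma cone_opensE:
  assumes "U \<in> cone_opens P X p" and "x \<in> U"
  obtains c where "cone_ll P 0 c" and "cone_ball P X p x c \<subseteq> U"
  using assms(1)[unfolded in_cone_opens_iff, THEN conjunct2, THEN bspec, OF assms(2)] by blast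

lemma cone_opensI:
  assumes "U \<subseteq> X" and "\<And>x. x \<in> U \<Longrightarrow> \<exists>c. cone_ll P 0 c \<and> cone_ball P X p x c \<subseteq> U"
  shows "U \<in> cone_opens P X p"
  using assms by (simp add: in_cone_opens_iff)

text \<open>Two radii need not have a minimum in \<open>E\<close>, so for an intersection a common smaller radius is
  found among the multiples \<open>e / n\<close> of an interior point.\<close>

lemma istopology_cone_opens:
  fixes P :: "'e::hausdorff_locally_convex set"
  assumes P: "pointed_cone P" and e: "e \<in> interior P"
  shows "istopology (\<lambda>U. U \<in> cone_opens P X p)"
  unfolding istopology_def
proof (intro conjI allI impI)
  fix S T
  assume S: "S \<in> cone_opens P X p" and T: "T \<in> cone_opens P X p"
  show "S \<inter> T \<in> cone_opens P X p"
  proof (rule cone_opensI)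
    show "S \<inter> T \<subseteq> X"
      using S by (auto simp: in_cone_opens_iff)
    fix x
    assume "x \<in> S \<inter> T"
    then have "x \<in> S" "x \<in> T"
      by simp_all
    obtain a where a: "cone_ll P 0 a" "cone_ball P X p x a \<subseteq> S"
      by (rule cone_opensE[OF S \<open>x \<in> S\<close>])
    obtain b where b: "cone_ll P 0 b" "cone_ball P X p x b \<subseteq> T"
      by (rule cone_opensE[OF T \<open>x \<in> T\<close>])
    define r where "r n = inverse (real (Suc n)) *\<^sub>R e" for n
    have "\<forall>\<^sub>F n in sequentially. cone_ll P (r n) a \<and> cone_ll P (r n) b"
      unfolding r_def by (intro eventually_conj eventually_cone_ll_inverse_scaleR a(1) b(1))
    then obtain n where n: "cone_ll P (r n) a" "cone_ll P (r n) b"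
      using eventually_happens'[OF sequentially_bot] by fast
    have "cone_ball P X p x (r n) \<subseteq> S \<inter> T"
      by (intro Int_greatest order_trans[OF cone_ball_subset[OF P n(1)] a(2)]
          order_trans[OF cone_ball_subset[OF P n(2)] b(2)])
    moreover have "cone_ll P 0 (r n)"
      unfolding r_def by (rule cone_ll_inverse_scaleR[OF P e])
    ultimately show "\<exists>c. cone_ll P 0 c \<and> cone_ball P X p x c \<subseteq> S \<inter> T"
      by blast
  qed
next
  fix \<K>
  assume K: "\<forall>K\<in>\<K>. K \<in> cone_opens P X p"
  show "\<Union>\<K> \<in> cone_opens P X p"
  proof (rule cone_opensI)
    show "\<Union>\<K> \<subseteq> X"
      using K by (auto simp: in_cone_opens_iff)
    fix x
    assume "x \<in> \<Union>\<K>"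
    then obtain K where "x \<in> K" "K \<in> \<K>"
      by blast
    then obtain c where "cone_ll P 0 c" "cone_ball P X p x c \<subseteq> K"
      using K cone_opensE by metis
    then show "\<exists>c. cone_ll P 0 c \<and> cone_ball P X p x c \<subseteq> \<Union>\<K>"
      using \<open>K \<in> \<K>\<close> by blast
  qed
qed

theorem theorem16:
  fixes P :: "'e::hausdorff_locally_convex set"
    and X :: "'a set"
    and p :: "'a \<Rightarrow> 'a \<Rightarrow> 'e"
  assumes "pointed_cone P" and "closed P" and "interior P \<noteq> {}"
    and "tvs_cone_metric_space P X p"
  shows "istopology (\<lambda>U. U \<in> cone_opens P X p) \<and>
         topspace (cone_topology P X p) = X \<and>
         first_countable (cone_topology P X p)"
proof -
  note P = assms(1) and M = assms(4)
  obtain e where e: "e \<in> interior P"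
    using assms(3) by blast
  have top: "istopology (\<lambda>U. U \<in> cone_opens P X p)"
    by (rule istopology_cone_opens[OF P e])
  then have openin: "openin (cone_topology P X p) U \<longleftrightarrow> U \<in> cone_opens P X p" for U
    by (simp add: cone_topology_def topology_inverse')
  define B where "B x n = cone_ball P X p x (inverse (real (Suc n)) *\<^sub>R e)" for x n
  have "X \<in> cone_opens P X p"
    using cone_ll_inverse_scaleR[OF P e] by (auto simp: in_cone_opens_iff cone_ball_def)
  then have space: "topspace (cone_topology P X p) = X"
    by (auto simp: topspace_def openin in_cone_opens_iff)
  have "\<exists>\<B>. countable \<B> \<and> (\<forall>V\<in>\<B>. openin (cone_topology P X p) V) \<and>
      (\<forall>U. openin (cone_topology P X p) U \<and> x \<in> U \<longrightarrow> (\<exists>V\<in>\<B>. x \<in> V \<and> V \<subseteq> U))"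
    if x: "x \<in> X" for x
  proof (intro exI[of _ "range (B x)"] conjI allI impI)
    show "\<forall>V\<in>range (B x). openin (cone_topology P X p) V"
      using cone_ball_in_cone_opens[OF P M x] by (auto simp: openin B_def)
    fix U
    assume "openin (cone_topology P X p) U \<and> x \<in> U"
    then obtain c where c: "cone_ll P 0 c" "cone_ball P X p x c \<subseteq> U"
      by (auto simp: openin in_cone_opens_iff)
    obtain n where "cone_ll P (inverse (real (Suc n)) *\<^sub>R e) c"
      using eventually_happens'[OF sequentially_bot eventually_cone_ll_inverse_scaleR[OF c(1)]]
      by blast
    then have "B x n \<subseteq> U"
      unfolding B_def by (rule order_trans[OF cone_ball_subset[OF P] c(2)])
    moreover have "x \<in> B x n"
      unfolding B_def by (intro centre_in_cone_ball[OF M x] cone_ll_inverse_scaleR[OF P e])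
    ultimately show "\<exists>V\<in>range (B x). x \<in> V \<and> V \<subseteq> U"
      by blast
  qed simp
  then have "first_countable (cone_topology P X p)"
    by (simp add: first_countable_def space)
  with top space show ?thesis
    by blast
qed

end
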